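(* Let $X, Y, Z, W$ be Banach spaces such that $X$ and $Y$ embed continuously into $Z$. Let $A\in L(Z,W)$ and $A_n\in L(Z, W)$ ($n\in\mathbb{N}$, $n\geq 1$) be operators such that for all $n\ge 1$ \[ \|A_n - A\|_{L(X,W)} \leq C_X\,n^{-\alpha}, \qquad \|A_n-A\|_{L(Y,W)} \geq c_Y\,n^{-\beta}, \qquad \|A_n - A\|_{L(Z,W)} \leq C_Z \] for real numbers $\alpha,\beta$ with $\beta<\frac{\alpha}{2}$ and constants $C_X, c_Y, C_Z>0$. Then there exists $y\in Y$ with $\|y\|_Y\leq 1$ such that for every $\gamma > \frac{\beta}{\alpha-\beta}$ we have \[ \limsup_{t\to\infty} \left(t^\gamma \inf_{\|x\|_X\leq t} \|x-y\|_Z\right) = \infty. \]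
   Context: For Banach spaces $U,V$, $L(U,V)$ is the space of continuous linear maps $U\to V$ with the operator norm. The norms $\|A_n-A\|_{L(X,W)}$ and $\|A_n-A\|_{L(Y,W)}$ are the operator norms of the restrictions of $A_n-A$ to $X$ and $Y$ via the continuous embeddings, e.g. $\|A_n-A\|_{L(X,W)}=\sup_{\|x\|_X\le 1}\|(A_n-A)x\|_W$. Elements of $X$ and $Y$ are identified with their images in $Z$ when computing $\|x-y\|_Z$. *)

theory Defs
  imports "HOL-Analysis.Analysis"
begin

end

theory Submission
  imports Defs "HOL-Real_Asymp.Real_Asymp"
begin

text \<open>
  Write $E_n = A_n - A$. If $x \in X$ has norm at most $t$, then
  $\|E_n y\| \le C_X n^{-\alpha} t + C_Z \|x - y\|$, so a lower bound for $\|E_n y\|$ forces $y$ to be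
  far from the ball of radius $t$ in $X$. The uniform boundedness principle, applied to
  $n^\beta \ln(n+2)\, E_n|_Y$, yields one $y$ in the unit ball of $Y$ with
  $\|E_n y\| \ge 2 n^{-\beta} / \ln(n+2)$ for infinitely many $n$. Choosing
  $t_n = n^{\alpha-\beta} / (C_X \ln(n+2))$ then leaves a distance of at least
  $n^{-\beta} / (C_Z \ln(n+2))$, and $(\alpha-\beta)\gamma > \beta$ beats the logarithms for every
  admissible $\gamma$ at once.
\<close>

text \<open>Uniform boundedness by Baire category: the closed sets \<open>T k\<close> of points
  where all \<open>F n\<close> are bounded by \<open>k\<close> exhaust the complete space, so one of
  them contains a ball, and differences of points of that ball bound every \<open>F n\<close> near
  0.\<close>

lemma Bseq_blinfun_pointwise:
  fixes F :: "nat \<Rightarrow> 'a::banach \<Rightarrow>\<^sub>L 'b::real_normed_vector"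
  assumes "\<And>x. Bseq (\<lambda>n. F n x)"
  shows "Bseq F"
proof -
  define T where "T k = (\<Inter>n. {x. norm (F n x) \<le> real k})" for k :: nat
  have closed_T: "closed (T k)" for k
    unfolding T_def by (intro closed_INT ballI closed_Collect_le continuous_intros)
  have cover: "\<Union>(range T) = UNIV"
  proof -
    have "\<exists>k. x \<in> T k" for x
    proof -
      obtain K where "\<And>n. norm (F n x) \<le> K"
        using assms[of x] unfolding Bseq_def by blast
      moreover obtain k :: nat where "K \<le> real k"
        using real_arch_simple by blast
      ultimately have "x \<in> T k"
        unfolding T_def by (auto intro: order_trans)
      then show ?thesis ..
    qed
    then show ?thesis by blast
  qed
  have "\<exists>k. interior (T k) \<noteq> {}"
  proof (rule ccontr)
    assume "\<not> ?thesis"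
    \<comment> \<open>Baire: a countable union of closed sets with empty interior has empty
      interior, yet this union is the whole space.\<close>
    then have "Met_TC.mtopology interior_of \<Union>(range T) = {}"
      by (intro Met_TC.metric_Baire_category_alt) (auto simp: closed_T complete_UNIV)
    then show False by (simp add: cover)
  qed
  then obtain k a where "a \<in> interior (T k)" by blast
  then obtain r where r: "r > 0" "cball a r \<subseteq> T k"
    by (meson mem_interior_cball)
  have T_bound: "norm (F n x) \<le> real k" if "dist a x \<le> r" for n x
    using r that by (auto simp: T_def)
  have "norm (F n) \<le> 2 * real k / r" for n
  proof (rule norm_blinfun_bound)
    fix x
    show "norm (F n x) \<le> 2 * real k / r * norm x"
    proof (cases "x = 0")
      case False
      \<comment> \<open>Rescaling \<open>x\<close> to norm \<open>r\<close> puts both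
        \<open>a\<close> and \<open>a + u\<close> in the ball where the bound \<open>k\<close>
        holds.\<close>
      define u where "u = (r / norm x) *\<^sub>R x"
      have "F n u = F n (a + u) - F n a"
        by (simp add: blinfun.add_right)
      also have "norm \<dots> \<le> real k + real k"
        using T_bound[of "a + u" n] T_bound[of a n] \<open>r > 0\<close> False
        by (intro norm_triangle_le_diff add_mono) (auto simp: u_def dist_norm)
      finally have "r / norm x * norm (F n x) \<le> 2 * real k"
        using \<open>r > 0\<close> by (simp add: u_def blinfun.scaleR_right)
      then show ?thesis using False \<open>r > 0\<close> by (simp add: field_simps)
    qed simp
  qed (use \<open>r > 0\<close> in simp)
  then show ?thesis by (rule BseqI')
qed

text \<open>The contrapositive, with the witness normalised to the unit ball. Infinitely many large
  values are available because an eventual bound already gives \<open>Bseq\<close>.\<close>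

corollary unbounded_blinfun_frequently_large:
  fixes F :: "nat \<Rightarrow> 'a::banach \<Rightarrow>\<^sub>L 'b::real_normed_vector"
  assumes "\<not> Bseq F"
  obtains y where "norm y \<le> 1" "\<And>K. \<exists>\<^sub>F n in sequentially. norm (F n y) > K"
proof -
  obtain x where x: "\<not> Bseq (\<lambda>n. F n x)"
    using assms Bseq_blinfun_pointwise by blast
  show thesis
  proof (rule that[of "sgn x"])
    show "norm (sgn x) \<le> 1" by (simp add: norm_sgn)
    show "\<exists>\<^sub>F n in sequentially. norm (F n (sgn x)) > K" for K
    proof (rule ccontr)
      assume "\<not> ?thesis"
      then have K: "\<forall>\<^sub>F n in sequentially. norm (F n (sgn x)) \<le> K"
        by (simp add: not_frequently not_less)
      have scale: "F n x = norm x *\<^sub>R F n (sgn x)" for n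
        by (cases "x = 0") (simp_all add: sgn_div_norm blinfun.scaleR_right)
      from K have "\<forall>\<^sub>F n in sequentially. norm (F n x) \<le> norm x * K"
        unfolding scale by eventually_elim (simp add: mult_left_mono)
      with x show False by (blast intro: BfunI)
    qed
  qed
qed

text \<open>A negative \<open>\<beta>\<close> would make the left-hand side tend to infinity. This
  supplies the sign of \<open>\<beta>\<close> from which \<open>\<alpha> - \<beta> > 0\<close>
  follows.\<close>

lemma exponent_nonneg_if_bounded_below:
  fixes c \<beta> B :: real
  assumes "c > 0" and "\<And>n::nat. n \<ge> 1 \<Longrightarrow> c * real n powr (- \<beta>) \<le> B"
  shows "\<beta> \<ge> 0"
proof (rule ccontr)
  assume "\<not> ?thesis"
  then have "- \<beta> > 0" by simp
  then have "filterlim (\<lambda>n::nat. c * real n powr (- \<beta>)) at_top sequentially"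
    using \<open>c > 0\<close> by real_asymp
  then have "\<forall>\<^sub>F n in sequentially. c * real n powr (- \<beta>) > B"
    by (simp add: filterlim_at_top_dense)
  then have "\<forall>\<^sub>F n::nat in sequentially. False"
    using eventually_ge_at_top[of 1] by eventually_elim (use assms(2) in fastforce)
  then show False by simp
qed

text \<open>A finite limsup would bound \<open>f\<close> eventually, hence along \<open>t\<close>,
  while \<open>l\<close> outgrows every bound; infinitely many \<open>n\<close> with
  \<open>f (t n) \<ge> l n\<close> suffice for the contradiction.\<close>

lemma Limsup_at_top_eq_infinity:
  fixes f g :: "real \<Rightarrow> real" and t l :: "nat \<Rightarrow> real"
  assumes "filterlim t at_top sequentially" and "filterlim l at_top sequentially"
    and "\<exists>\<^sub>F n in sequentially. f (t n) \<ge> l n"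
  shows "Limsup at_top (\<lambda>x. ereal (f x)) = \<infinity>"
proof (rule ccontr)
  assume "\<not> ?thesis"
  then obtain c :: real where "Limsup at_top (\<lambda>x. ereal (f x)) < ereal c"
    using less_PInf_Ex_of_nat by auto
  then have "\<forall>\<^sub>F x in at_top. f x < c"
    by (auto dest: Limsup_lessD)
  then have "\<forall>\<^sub>F n in sequentially. f (t n) < c"
    using assms(1) by (rule eventually_compose_filterlim)
  moreover have "\<forall>\<^sub>F n in sequentially. c \<le> l n"
    using assms(2) by (simp add: filterlim_at_top)
  ultimately have "\<forall>\<^sub>F n in sequentially. \<not> f (t n) \<ge> l n"
    by eventually_elim linarith
  with assms(3) show False by (simp add: frequently_def)
qed

text \<open>Up to constants the product is n to the power \<open>a * \<gamma> - b\<close>, which is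
  a positive exponent, divided by a power of the logarithm.\<close>

lemma rate_filterlim_at_top:
  fixes a b c d \<gamma> :: real
  assumes "a > 0" "\<gamma> > b / a" "c > 0" "d > 0"
  shows "filterlim (\<lambda>n::nat. (real n powr a / (c * ln (real n + 2))) powr \<gamma>
           * (real n powr (- b) / (d * ln (real n + 2)))) at_top sequentially"
proof -
  have "a * \<gamma> - b > 0" using assms by (simp add: field_simps)
  then have "filterlim (\<lambda>n::nat. real n powr (a * \<gamma> - b) / (c powr \<gamma> * d * ln (real n + 2) powr (\<gamma> + 1)))
      at_top sequentially"
    using assms by real_asymp
  moreover have "\<forall>\<^sub>F n::nat in sequentially.
      real n powr (a * \<gamma> - b) / (c powr \<gamma> * d * ln (real n + 2) powr (\<gamma> + 1))
      = (real n powr a / (c * ln (real n + 2))) powr \<gamma> * (real n powr (- b) / (d * ln (real n + 2)))"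
    using eventually_gt_at_top[of 0]
  proof eventually_elim
    case (elim n)
    define l where "l = ln (real n + 2)"
    have "l > 0" by (simp add: l_def)
    have "(real n powr a / (c * l)) powr \<gamma> = real n powr (a * \<gamma>) / (c powr \<gamma> * l powr \<gamma>)"
      using \<open>c > 0\<close> \<open>l > 0\<close> by (simp add: powr_divide powr_mult powr_powr)
    moreover have "real n powr (a * \<gamma> - b) = real n powr (a * \<gamma>) * real n powr (- b)"
      using elim by (simp flip: powr_add)
    moreover have "l powr (\<gamma> + 1) = l powr \<gamma> * l"
      using \<open>l > 0\<close> by (simp add: powr_add)
    ultimately show ?case
      unfolding l_def[symmetric] by simp
  qed
  ultimately show ?thesis
    by (blast intro: filterlim_mono_eventually)
qed

theorem lemma2p3:
  fixes \<iota>X :: "'x::banach \<Rightarrow>\<^sub>L 'z::banach"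
    and \<iota>Y :: "'y::banach \<Rightarrow>\<^sub>L 'z"
    and A :: "'z \<Rightarrow>\<^sub>L 'w::banach"
    and A_seq :: "nat \<Rightarrow> 'z \<Rightarrow>\<^sub>L 'w"
    and \<alpha> \<beta> C_X c_Y C_Z :: real
  assumes "inj (blinfun_apply \<iota>X)"
    and "inj (blinfun_apply \<iota>Y)"
    and "C_X > 0" and "c_Y > 0" and "C_Z > 0"
    and "\<beta> < \<alpha> / 2"
    and "\<And>n. n \<ge> 1 \<Longrightarrow> norm ((A_seq n - A) o\<^sub>L \<iota>X) \<le> C_X * real n powr (- \<alpha>)"
    and "\<And>n. n \<ge> 1 \<Longrightarrow> norm ((A_seq n - A) o\<^sub>L \<iota>Y) \<ge> c_Y * real n powr (- \<beta>)"
    and "\<And>n. n \<ge> 1 \<Longrightarrow> norm (A_seq n - A) \<le> C_Z"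
  shows "\<exists>y. norm y \<le> 1 \<and>
    (\<forall>\<gamma> > \<beta> / (\<alpha> - \<beta>).
      Limsup at_top (\<lambda>t::real.
        ereal (t powr \<gamma> * (INF x\<in>{x. norm x \<le> t}. norm (\<iota>X x - \<iota>Y y)))) = \<infinity>)"
proof -
  define E where "E n = A_seq n - A" for n
  \<comment> \<open>The shift by 2 keeps the logarithm positive even at
    \<open>n = 0\<close>.\<close>
  define L where "L n = ln (real n + 2)" for n :: nat
  have L_pos: "L n > 0" for n by (simp add: L_def)
  have "c_Y * real n powr (- \<beta>) \<le> C_Z * norm \<iota>Y" if "n \<ge> 1" for n
  proof -
    have "c_Y * real n powr (- \<beta>) \<le> norm (E n) * norm \<iota>Y"
      using assms(8)[OF that] norm_blinfun_compose[of "E n" \<iota>Y] by (simp add: E_def)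
    also have "\<dots> \<le> C_Z * norm \<iota>Y"
      using assms(9)[OF that] by (simp add: E_def mult_right_mono)
    finally show ?thesis .
  qed
  then have "\<beta> \<ge> 0" using assms(4) exponent_nonneg_if_bounded_below by blast
  \<comment> \<open>Indeed \<alpha> - \<beta> > \<beta> \<ge> 0.\<close>
  then have "\<alpha> - \<beta> > 0" using assms(6) by simp

  \<comment> \<open>The power of n cancels the assumed decay on Y, so \<open>norm (F n)\<close> is
    at least \<open>c_Y * L n\<close>: the logarithm alone makes the family unbounded. The weight
    does not involve \<gamma>, hence neither does \<open>y\<close>.\<close>
  define F where "F n = (real n powr \<beta> * L n) *\<^sub>R (E n o\<^sub>L \<iota>Y)" for n
  have "\<not> Bseq F"
  proof
    assume "Bseq F"
    then obtain K where K: "\<And>n. norm (F n) \<le> K" unfolding Bseq_def by blast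
    have "filterlim (\<lambda>n. c_Y * L n) at_top sequentially"
      using assms(4) unfolding L_def by real_asymp
    then have "\<forall>\<^sub>F n in sequentially. c_Y * L n > K"
      by (simp add: filterlim_at_top_dense)
    then have "\<forall>\<^sub>F n::nat in sequentially. False"
      using eventually_ge_at_top[of 1]
    proof eventually_elim
      case (elim n)
      have "c_Y * L n = real n powr \<beta> * L n * (c_Y * real n powr (- \<beta>))"
        using elim by (simp add: powr_minus)
      also have "\<dots> \<le> real n powr \<beta> * L n * norm (E n o\<^sub>L \<iota>Y)"
        using assms(8)[of n] elim L_pos[of n] by (intro mult_left_mono) (auto simp: E_def)
      also have "\<dots> = norm (F n)"
        using L_pos[of n] by (simp add: F_def)
      finally show False using K[of n] elim by linarith
    qed
    then show False by simp
  qed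
  then obtain y where y: "norm y \<le> 1" "\<And>K. \<exists>\<^sub>F n in sequentially. norm (F n y) > K"
    using unbounded_blinfun_frequently_large by blast

  \<comment> \<open>Chosen so that the X-term \<open>C_X * real n powr (- \<alpha>) * t n\<close> is
    exactly \<open>real n powr (- \<beta>) / L n\<close>. The threshold 2 below provides twice this
    amount, and the remaining half bounds the distance.\<close>
  define t where "t n = real n powr (\<alpha> - \<beta>) / (C_X * L n)" for n
  have dist_lower: "real n powr (- \<beta>) / (C_Z * L n) \<le> norm (\<iota>X x - \<iota>Y y)"
    if n: "n \<ge> 1" "norm (F n y) > 2" and x: "norm x \<le> t n" for n x
  proof -
    have F_y: "norm (F n y) = real n powr \<beta> * L n * norm (E n (\<iota>Y y))"
      using L_pos[of n] by (simp add: F_def blinfun.scaleR_left)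
    have "2 * (real n powr (- \<beta>) / L n) \<le> norm (E n (\<iota>Y y))"
      using n L_pos[of n] unfolding F_y by (simp add: powr_minus field_simps)
    \<comment> \<open>Write y = x - (x - y): the first part is controlled by the X-rate, the second
      only by \<open>C_Z\<close>.\<close>
    also have "E n (\<iota>Y y) = (E n o\<^sub>L \<iota>X) x - E n (\<iota>X x - \<iota>Y y)"
      by (simp add: blinfun.diff_right)
    also have "norm \<dots> \<le> norm (E n o\<^sub>L \<iota>X) * norm x + norm (E n) * norm (\<iota>X x - \<iota>Y y)"
      by (intro norm_triangle_le_diff add_mono norm_blinfun)
    also have "\<dots> \<le> C_X * real n powr (- \<alpha>) * t n + C_Z * norm (\<iota>X x - \<iota>Y y)"
      using assms(3,5,7,9) n x by (intro add_mono mult_mono) (auto simp: E_def)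
    also have "C_X * real n powr (- \<alpha>) * t n = real n powr (- \<beta>) / L n"
      using assms(3) n L_pos[of n] by (simp add: t_def powr_minus powr_diff field_simps)
    finally show ?thesis using assms(5) L_pos[of n] by (simp add: field_simps)
  qed
  have t_nonneg: "t n \<ge> 0" for n
    using assms(3) L_pos[of n] by (simp add: t_def)
  have t_lim: "filterlim t at_top sequentially"
    using assms(3) \<open>\<alpha> - \<beta> > 0\<close> unfolding t_def L_def by real_asymp

  have "Limsup at_top (\<lambda>t. ereal (t powr \<gamma> * (INF x\<in>{x. norm x \<le> t}. norm (\<iota>X x - \<iota>Y y)))) = \<infinity>"
    if "\<gamma> > \<beta> / (\<alpha> - \<beta>)" for \<gamma>
  proof (rule Limsup_at_top_eq_infinity[OF t_lim])
    show "filterlim (\<lambda>n. t n powr \<gamma> * (real n powr (- \<beta>) / (C_Z * L n))) at_top sequentially"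
      unfolding t_def L_def
      using rate_filterlim_at_top \<open>\<alpha> - \<beta> > 0\<close> that assms(3,5) by blast
    \<comment> \<open>The rate hypotheses, and so \<open>dist_lower\<close>, are available only for
      \<open>n \<ge> 1\<close>.\<close>
    have "\<exists>\<^sub>F n in sequentially. norm (F n y) > 2 \<and> n \<ge> 1"
      using y(2) eventually_ge_at_top by (rule frequently_eventually_frequently)
    then show "\<exists>\<^sub>F n in sequentially. t n powr \<gamma> * (real n powr (- \<beta>) / (C_Z * L n))
        \<le> t n powr \<gamma> * (INF x\<in>{x. norm x \<le> t n}. norm (\<iota>X x - \<iota>Y y))"
    proof (rule frequently_elim1)
      fix n assume "norm (F n y) > 2 \<and> n \<ge> 1"
      \<comment> \<open>The infimum is a real one, so a lower bound passes to it only over a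
        nonempty ball.\<close>
      moreover have "0 \<in> {x::'x. norm x \<le> t n}" using t_nonneg[of n] by simp
      ultimately have "real n powr (- \<beta>) / (C_Z * L n) \<le> (INF x\<in>{x. norm x \<le> t n}. norm (\<iota>X x - \<iota>Y y))"
        by (intro cINF_greatest) (blast, use dist_lower in auto)
      then show "t n powr \<gamma> * (real n powr (- \<beta>) / (C_Z * L n))
          \<le> t n powr \<gamma> * (INF x\<in>{x. norm x \<le> t n}. norm (\<iota>X x - \<iota>Y y))"
        by (rule mult_left_mono) simp
    qed
  qed
  with y(1) show ?thesis by blast
qed

end
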